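(* Let $(q_n)$ and $(p_n)$ be sequences with $q_n\in(0,1)$, $p_n\in(0,1]$, $q_n<p_n$, such that $q_n\to 1$ and $p_n\to 1$ as $n\to\infty$. Then for each function $f\in C_2^*[0,\infty)$, $$\lim_{n\to\infty}\left\|B_{n,p_n,q_n}^*f-f\right\|_2=0.$$
   Context: For $0<q<p\le 1$ and integers $n\ge k\ge 0$: $[n]_{p,q}=\frac{p^n-q^n}{p-q}$, $[n]_{p,q}!=[n]_{p,q}[n-1]_{p,q}\cdots[1]_{p,q}$ (with $[0]_{p,q}!=1$), $\left[\begin{array}{c}n\\k\end{array}\right]_{p,q}=\frac{[n]_{p,q}!}{[k]_{p,q}!\,[n-k]_{p,q}!}$, and $(1\oplus x)^n_{p,q}=\prod_{j=0}^{n-1}(p^j+q^jx)$. For $n\in\mathbb{N}=\{1,2,\dots\}$ and $x\in[0,\infty)$ set $$r_n(x)=\frac{-p^{n-1}+\sqrt{p^{2n-2}+4[n]_{p,q}\left([n]_{p,q}+p^n/q\right)x^2}}{2\left([n]_{p,q}+p^n/q\right)}\ \ge 0.$$ The King type modified $(p,q)$-Baskakov operator is $$B_{n,p,q}^*(f;x)=\sum_{k=0}^{\infty}\left[\begin{array}{c}n+k-1\\k\end{array}\right]_{p,q}p^{k+n(n-1)/2}q^{k(k-1)/2}\frac{r_n(x)^k}{(1\oplus r_n(x))^{n+k}_{p,q}}\,f\!\left(\frac{p^{n-1}[k]_{p,q}}{q^{k-1}[n]_{p,q}}\right),\qquad x\in[0,\infty),$$ and $B_{n,p,q}^*f$ denotes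 the function $x\mapsto B_{n,p,q}^*(f;x)$. In $B_{n,p_n,q_n}^*$ the parameters are $p=p_n$, $q=q_n$ (also inside $r_n$). For $m>0$, $B_m[0,\infty)$ is the space of functions $f:[0,\infty)\to\mathbb{R}$ with $|f(x)|\le M_f(1+x^m)$ for all $x\ge 0$, where $M_f$ is a constant depending on $f$; $C_m[0,\infty)=B_m[0,\infty)\cap C[0,\infty)$, with norm $\|f\|_m=\sup_{x\ge 0}\frac{|f(x)|}{1+x^m}$; and $C_m^*[0,\infty)$ is the set of $f\in C_m[0,\infty)$ for which $\lim_{x\to\infty}\frac{|f(x)|}{1+x^m}$ exists and is finite. *)

theory Defs
  imports "HOL-Analysis.Analysis"
begin

definition pq_num :: "real \<Rightarrow> real \<Rightarrow> nat \<Rightarrow> real" where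
  "pq_num p q n = (p ^ n - q ^ n) / (p - q)"

definition pq_fact :: "real \<Rightarrow> real \<Rightarrow> nat \<Rightarrow> real" where
  "pq_fact p q n = (\<Prod>i=1..n. pq_num p q i)"

definition pq_binomial :: "real \<Rightarrow> real \<Rightarrow> nat \<Rightarrow> nat \<Rightarrow> real" where
  "pq_binomial p q n k = pq_fact p q n / (pq_fact p q k * pq_fact p q (n - k))"

definition pq_power :: "real \<Rightarrow> real \<Rightarrow> nat \<Rightarrow> real \<Rightarrow> real" where
  "pq_power p q n x = (\<Prod>j<n. p ^ j + q ^ j * x)"

(* Used only for n \<ge> 1, so that the natural-number subtractions in the exponents are exact. *)
definition king_r :: "real \<Rightarrow> real \<Rightarrow> nat \<Rightarrow> real \<Rightarrow> real" where
  "king_r p q n x =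
     (- (p ^ (n - 1)) + sqrt (p ^ (2 * n - 2) + 4 * pq_num p q n * (pq_num p q n + p ^ n / q) * x\<^sup>2))
     / (2 * (pq_num p q n + p ^ n / q))"

(* Also used only for n \<ge> 1. The exponent k - 1 of q is an integer power, as it is -1 for k = 0. *)
definition king_baskakov :: "nat \<Rightarrow> real \<Rightarrow> real \<Rightarrow> (real \<Rightarrow> real) \<Rightarrow> real \<Rightarrow> real" where
  "king_baskakov n p q f x =
     (\<Sum>k. pq_binomial p q (n + k - 1) k
          * p ^ (k + n * (n - 1) div 2) * q ^ (k * (k - 1) div 2)
          * (king_r p q n x ^ k / pq_power p q (n + k) (king_r p q n x))
          * f (p ^ (n - 1) * pq_num p q k / (q powi (int k - 1) * pq_num p q n)))"

(* Functions on [0,\<infinity>) are represented by functions on the reals whose values at negative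
   arguments are irrelevant. *)
definition weighted_B :: "real \<Rightarrow> (real \<Rightarrow> real) set" where
  "weighted_B m = {f. \<exists>M. \<forall>x\<ge>0. \<bar>f x\<bar> \<le> M * (1 + x powr m)}"

definition weighted_C :: "real \<Rightarrow> (real \<Rightarrow> real) set" where
  "weighted_C m = {f \<in> weighted_B m. continuous_on {0..} f}"

definition weighted_Cstar :: "real \<Rightarrow> (real \<Rightarrow> real) set" where
  "weighted_Cstar m =
     {f \<in> weighted_C m. \<exists>L::real. ((\<lambda>x. \<bar>f x\<bar> / (1 + x powr m)) \<longlongrightarrow> L) at_top}"

(* The supremum is taken in the extended reals, so it is \<infinity> when the weighted function is
   unbounded, instead of an unspecified real number. *)
definition weighted_norm :: "real \<Rightarrow> (real \<Rightarrow> real) \<Rightarrow> ereal" where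
  "weighted_norm m f = (SUP x\<in>{0..}. ereal (\<bar>f x\<bar> / (1 + x powr m)))"

end

theory Submission imports Defs begin

text \<open>
  Everything in the operator is homogeneous in \<open>(p, q)\<close>: the powers of \<open>p\<close> cancel, and only the
  ratio \<open>\<rho> = q / p\<close>, which tends to 1, survives (\<open>king_baskakov_eq\<close>). This matters because
  \<open>[n]\<^bsub>p,q\<^esub>\<close> itself may tend to 0 (if \<open>p\<^sub>n\<close> approaches 1 slowly), whereas
  \<open>[n]\<^sub>\<rho> = 1 + \<rho> + \<dots> + \<rho>\<^bsup>n-1\<^esup>\<close> always tends to infinity (\<open>q_num_tendsto_at_top\<close>).

  For fixed \<open>0 < \<rho> < 1\<close> and \<open>r \<ge> 0\<close> the weights are the probability distribution of the number \<open>k\<close>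
  of successes before the \<open>n\<close>-th failure in independent trials \<open>j = 0, 1, \<dots>\<close> with success probability
  \<open>\<rho>\<^sup>j r / (1 + \<rho>\<^sup>j r)\<close>. The corresponding random node has mean \<open>r\<close> and second moment
  \<open>r\<^sup>2 + (r + r\<^sup>2 / \<rho>) / [n]\<^sub>\<rho>\<close>. The function \<open>r = r\<^sub>n(x)\<close> is the nonnegative solution of the quadratic
  equation that makes the second moment equal to \<open>x\<^sup>2\<close>. Hence the operator is positive, reproduces
  \<open>1\<close> and \<open>t\<^sup>2\<close>, and maps \<open>(t - x)\<^sup>2\<close> to
  \<open>2 x (x - r) \<le> 2 (x\<^sup>2 - r\<^sup>2) = O((1 + x\<^sup>2) / [n]\<^sub>\<rho>)\<close>.

  The conclusion is then a weighted Korovkin argument. A function in the class is asymptotically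
  \<open>L (1 + t\<^sup>2)\<close> for a signed constant \<open>L\<close>. The operator fixes \<open>L (1 + t\<^sup>2)\<close>, and the increments of the
  remainder are bounded by \<open>\<epsilon> (2 + t\<^sup>2 + x\<^sup>2) + C (t - x)\<^sup>2\<close> (\<open>weighted_Cstar_increment_bound\<close>).
  Applying the operator in \<open>t\<close> bounds the error by \<open>2 \<epsilon> (1 + x\<^sup>2)\<close> plus a multiple of
  \<open>(1 + x\<^sup>2) / [n]\<^sub>\<rho>\<close> (\<open>king_baskakov_error\<close>), uniformly after division by \<open>1 + x\<^sup>2\<close>.
\<close>

section \<open>Homogeneity: reduction to the ratio of the parameters\<close>

lemma triangular_Suc: "Suc n * n div 2 = n * (n - 1) div 2 + n"
proof -
  have "Suc n * n = n * (n - 1) + 2 * n"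
    by (cases n) (auto simp: algebra_simps)
  then show ?thesis by simp
qed

lemma triangular_add:
  fixes m k :: nat
  shows "(m + k) * (m + k - 1) div 2 = m * (m - 1) div 2 + k * (k - 1) div 2 + m * k"
proof (induction k)
  case (Suc k)
  show ?case using Suc triangular_Suc[of "m + k"] triangular_Suc[of k] by simp
qed simp

lemma pq_num_homogeneous:
  assumes "0 < q" "q < p"
  shows "pq_num p q (Suc n) = p ^ n * pq_num 1 (q / p) (Suc n)"
  using assms by (simp add: pq_num_def field_simps)

lemma pq_fact_Suc: "pq_fact p q (Suc n) = pq_num p q (Suc n) * pq_fact p q n"
  by (simp add: pq_fact_def)

lemma pq_fact_homogeneous:
  assumes "0 < q" "q < p"
  shows "pq_fact p q n = p ^ (n * (n - 1) div 2) * pq_fact 1 (q / p) n"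
proof (induction n)
  case 0
  then show ?case by (simp add: pq_fact_def)
next
  case (Suc n)
  then show ?case
    using triangular_Suc[of n]
    by (simp add: pq_fact_Suc pq_num_homogeneous[OF assms] power_add)
qed

lemma pq_power_homogeneous:
  assumes "0 < p"
  shows "pq_power p q n x = p ^ (n * (n - 1) div 2) * pq_power 1 (q / p) n x"
proof (induction n)
  case 0
  then show ?case by (simp add: pq_power_def)
next
  case (Suc n)
  have "p ^ n + q ^ n * x = p ^ n * (1 + (q / p) ^ n * x)"
    using assms by (simp add: field_simps)
  with Suc show ?case
    using triangular_Suc[of n]
    by (simp add: pq_power_def power_add)
qed

lemma pq_binomial_homogeneous:
  assumes "0 < q" "q < p"
  shows "pq_binomial p q (m + k) k = p ^ (m * k) * pq_binomial 1 (q / p) (m + k) k"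
proof -
  have "p > 0" using assms by simp
  then show ?thesis
    unfolding pq_binomial_def pq_fact_homogeneous[OF assms] triangular_add
    by (simp add: power_add)
qed

text \<open>
  The index is \<open>m = n - 1\<close>, so that the case \<open>n \<ge> 1\<close> of the operator needs no truncated subtraction and
  inductions over \<open>n\<close> start at \<open>m = 0\<close>. The power \<open>q\<^bsup>k-1\<^esup>\<close> in the nodes becomes \<open>\<rho>\<^sup>k / \<rho>\<close>, which avoids
  a negative exponent at \<open>k = 0\<close>.
\<close>

definition baskakov_weight :: "real \<Rightarrow> nat \<Rightarrow> real \<Rightarrow> nat \<Rightarrow> real" where
  "baskakov_weight \<rho> m r k =
     pq_binomial 1 \<rho> (m + k) k * \<rho> ^ (k * (k - 1) div 2) * r ^ k / pq_power 1 \<rho> (Suc (m + k)) r"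

definition baskakov_node :: "real \<Rightarrow> nat \<Rightarrow> nat \<Rightarrow> real" where
  "baskakov_node \<rho> n k = \<rho> * pq_num 1 \<rho> k / (\<rho> ^ k * pq_num 1 \<rho> n)"

text \<open>
  The total exponent of \<open>p\<close> in the weight vanishes, since
  \<open>m k + k + m (m + 1) / 2 + k (k - 1) / 2 = (m + 1 + k) (m + k) / 2\<close>; this is the addition formula for
  triangular numbers, used for \<open>m + 1\<close> and \<open>k\<close>.
\<close>

lemma king_baskakov_eq:
  fixes m :: nat
  assumes "0 < q" "q < p"
  defines "r \<equiv> king_r p q (Suc m)"
  shows "king_baskakov (Suc m) p q f x =
    (\<Sum>k. baskakov_weight (q / p) m (r x) k * f (baskakov_node (q / p) (Suc m) k))"
proof -
  have p: "p > 0" using assms by simp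
  have node: "p ^ (Suc m - 1) * pq_num p q k / (q powi (int k - 1) * pq_num p q (Suc m))
      = baskakov_node (q / p) (Suc m) k" for k
  proof (cases k)
    case 0
    then show ?thesis by (simp add: baskakov_node_def pq_num_def)
  next
    case (Suc j)
    have "q powi (int k - 1) = q ^ j" using Suc by simp
    then show ?thesis using p assms(1) Suc
      by (simp add: baskakov_node_def pq_num_homogeneous[OF assms(1,2)] power_divide)
  qed
  have weight: "pq_binomial p q (Suc m + k - 1) k
          * p ^ (k + Suc m * (Suc m - 1) div 2) * q ^ (k * (k - 1) div 2)
          * (y ^ k / pq_power p q (Suc m + k) y) = baskakov_weight (q / p) m y k" for k y
  proof -
    have e: "pq_power p q (Suc m + k) y =
       p ^ (Suc m * (Suc m - 1) div 2 + k * (k - 1) div 2 + Suc m * k) * pq_power 1 (q / p) (Suc m + k) y"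
      by (simp only: pq_power_homogeneous[OF p] triangular_add)
    have qq: "q ^ (k * (k - 1) div 2) = p ^ (k * (k - 1) div 2) * (q / p) ^ (k * (k - 1) div 2)"
      using p by (simp add: power_divide)
    have b: "pq_binomial p q (Suc m + k - 1) k = p ^ (m * k) * pq_binomial 1 (q / p) (m + k) k"
      using pq_binomial_homogeneous[OF assms(1,2)] by simp
    have cancel: "u * B * A * (C * D) * (Y / (X * P)) = B * D * Y / P"
      if "X = u * A * C" "X \<noteq> 0" for u A B C D P X Y :: real
    proof -
      have "u * B * A * (C * D) * (Y / (X * P)) = X * (B * D * Y) / (X * P)"
        using that(1) by simp
      then show ?thesis using that(2) by simp
    qed
    have "baskakov_weight (q / p) m y k =
      pq_binomial 1 (q / p) (m + k) k * (q / p) ^ (k * (k - 1) div 2) * y ^ k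
        / pq_power 1 (q / p) (Suc m + k) y"
      by (simp add: baskakov_weight_def)
    then show ?thesis unfolding e qq b using p
      by (simp only:) (rule cancel, simp_all add: power_add)
  qed
  show ?thesis unfolding king_baskakov_def r_def weight node ..
qed

section \<open>Moments of the Baskakov weights\<close>

context
  fixes \<rho> :: real
  assumes rho: "0 < \<rho>" "\<rho> < 1"
begin

lemma q_num_Suc: "pq_num 1 \<rho> (Suc n) = pq_num 1 \<rho> n + \<rho> ^ n"
  using rho by (simp add: pq_num_def field_simps)

lemma q_num_0: "pq_num 1 \<rho> 0 = 0"
  by (simp add: pq_num_def)

lemma q_num_eq_sum: "pq_num 1 \<rho> n = (\<Sum>i<n. \<rho> ^ i)"
  by (induction n) (simp_all add: q_num_0 q_num_Suc)

lemma q_num_add: "pq_num 1 \<rho> (m + k) = pq_num 1 \<rho> m + \<rho> ^ m * pq_num 1 \<rho> k"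
  by (induction k) (simp_all add: q_num_0 q_num_Suc power_add algebra_simps)

lemma q_num_pos: "pq_num 1 \<rho> (Suc n) > 0"
  using rho by (simp add: pq_num_def power_Suc_less_one del: power_Suc)

lemma q_fact_0: "pq_fact 1 \<rho> 0 = 1"
  by (simp add: pq_fact_def)

lemma q_fact_pos: "pq_fact 1 \<rho> n > 0"
proof (induction n)
  case 0
  then show ?case by (simp add: q_fact_0)
qed (simp add: pq_fact_Suc q_num_pos)

text \<open>
  Over the common denominator this is \<open>[m + 1 + j + 1] = [m + 1] + \<rho>\<^bsup>m+1\<^esup> [j + 1]\<close>.
\<close>

lemma q_binomial_Pascal:
  "pq_binomial 1 \<rho> (Suc m + Suc j) (Suc j) =
   pq_binomial 1 \<rho> (m + Suc j) (Suc j) + \<rho> ^ Suc m * pq_binomial 1 \<rho> (Suc m + j) j"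
proof -
  define N where "N = pq_num 1 \<rho> (Suc (Suc (m + j)))"
  define a where "a = pq_num 1 \<rho> (Suc m)"
  define b where "b = pq_num 1 \<rho> (Suc j)"
  define F where "F = pq_fact 1 \<rho>"
  have N: "N = a + \<rho> ^ Suc m * b"
    using q_num_add[of "Suc m" "Suc j"] by (simp add: N_def a_def b_def)
  have pos: "a > 0" "b > 0" "F m > 0" "F j > 0"
    by (simp_all add: a_def b_def F_def q_num_pos q_fact_pos)
  have l: "pq_binomial 1 \<rho> (Suc m + Suc j) (Suc j) = N * F (Suc (m + j)) / (b * F j * (a * F m))"
    by (simp add: pq_binomial_def F_def N_def a_def b_def pq_fact_Suc)
  have r1: "pq_binomial 1 \<rho> (m + Suc j) (Suc j) = F (Suc (m + j)) / (b * F j * F m)"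
    by (simp add: pq_binomial_def F_def b_def pq_fact_Suc)
  have r2: "pq_binomial 1 \<rho> (Suc m + j) j = F (Suc (m + j)) / (F j * (a * F m))"
    by (simp add: pq_binomial_def F_def a_def pq_fact_Suc)
  show ?thesis unfolding l r1 r2 N using pos by (simp add: field_simps)
qed

lemma q_binomial_absorb:
  "pq_binomial 1 \<rho> (m + Suc j) (Suc j) * pq_num 1 \<rho> (Suc j) =
   pq_num 1 \<rho> (Suc m) * pq_binomial 1 \<rho> (Suc m + j) j"
  using q_num_pos[of m] q_num_pos[of j] q_fact_pos[of m] q_fact_pos[of j]
  by (simp add: pq_binomial_def pq_fact_Suc)

context
  fixes r :: real
  assumes r: "0 \<le> r"
begin

lemma q_power_pos: "pq_power 1 \<rho> n r > 0"
  unfolding pq_power_def using rho r by (intro prod_pos) (simp add: add_pos_nonneg)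

lemma q_power_Suc: "pq_power 1 \<rho> (Suc n) r = pq_power 1 \<rho> n r * (1 + \<rho> ^ n * r)"
  by (simp add: pq_power_def)

lemma baskakov_weight_nonneg: "0 \<le> baskakov_weight \<rho> m r k"
  unfolding baskakov_weight_def pq_binomial_def
  using rho r q_fact_pos q_power_pos by (simp add: less_imp_le)

text \<open>
  With \<open>n = 1\<close> the \<open>k\<close>-th weight is the probability that the first failure occurs after exactly \<open>k\<close>
  successes, the difference of the probabilities \<open>a k\<close> that the first \<open>k\<close> trials all succeed. Since the
  success probabilities decay geometrically, \<open>a k\<close> tends to 0.
\<close>

lemma baskakov_weight_0_sums: "baskakov_weight \<rho> 0 r sums 1"
proof -
  define a where "a k = \<rho> ^ (k * (k - 1) div 2) * r ^ k / pq_power 1 \<rho> k r" for k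
  have a0: "a 0 = 1" by (simp add: a_def pq_power_def)
  have a_nn: "0 \<le> a k" for k
    unfolding a_def using rho r q_power_pos[of k] by simp
  have a_Suc: "a (Suc k) = a k * (\<rho> ^ k * r / (1 + \<rho> ^ k * r))" for k
    using triangular_Suc[of k] by (simp add: a_def q_power_Suc power_add)
  have pos: "1 + \<rho> ^ k * r > 0" for k
    using rho r by (simp add: add_pos_nonneg)
  have w: "baskakov_weight \<rho> 0 r k = a k - a (Suc k)" for k
  proof -
    have "pq_binomial 1 \<rho> (0 + k) k = 1"
      using q_fact_pos[of k] q_fact_0 by (simp add: pq_binomial_def)
    then have "baskakov_weight \<rho> 0 r k = a k / (1 + \<rho> ^ k * r)"
      by (simp add: baskakov_weight_def a_def q_power_Suc)
    also have "\<dots> = a k - a (Suc k)"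
      using pos[of k] by (simp add: a_Suc field_simps)
    finally show ?thesis .
  qed
  have a_le: "a k \<le> 1" for k
  proof (induction k)
    case (Suc k)
    then show ?case
      using w[of k] baskakov_weight_nonneg[of 0 k] by simp
  qed (simp add: a0)
  have "a (Suc k) \<le> \<rho> ^ k * r" for k
  proof -
    have "\<rho> ^ k * r / (1 + \<rho> ^ k * r) \<le> \<rho> ^ k * r"
      using rho r pos[of k] by (simp add: divide_le_eq mult_left_le_one_le mult_le_cancel_left1)
    then have "a (Suc k) \<le> 1 * (\<rho> ^ k * r)"
      unfolding a_Suc using a_le[of k] a_nn[of k] rho r pos[of k]
      by (intro mult_mono) auto
    then show ?thesis by simp
  qed
  moreover have "(\<lambda>k. \<rho> ^ k * r) \<longlonglongrightarrow> 0"
    using rho by (intro tendsto_mult_left_zero LIMSEQ_power_zero) simp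
  ultimately have "(\<lambda>k. a (Suc k)) \<longlonglongrightarrow> 0"
    using a_nn Lim_null_comparison[of "\<lambda>k. a (Suc k)" "\<lambda>k. \<rho> ^ k * r"] by simp
  then have "a \<longlonglongrightarrow> 0" by (rule LIMSEQ_imp_Suc)
  from telescope_sums'[OF this] show ?thesis
    by (simp add: w[abs_def] a0)
qed

text \<open>
  Both sides are the probability of exactly \<open>k + 1\<close> successes in the trials \<open>0, \<dots>, m + k + 1\<close>; the two
  terms on the right distinguish whether the last of them fails or succeeds. The identity is arranged so that summation over \<open>k\<close> telescopes.
\<close>

lemma baskakov_weight_Pascal:
  "baskakov_weight \<rho> (Suc m) r (Suc k) * (1 + \<rho> ^ (Suc m + Suc k) * r) =
   baskakov_weight \<rho> m r (Suc k) + \<rho> ^ (Suc m + k) * r * baskakov_weight \<rho> (Suc m) r k"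
proof -
  define P where "P = pq_power 1 \<rho> (Suc (Suc (m + k))) r"
  have P: "P > 0" by (simp add: P_def q_power_pos)
  have s: "1 + \<rho> ^ (Suc m + Suc k) * r > 0"
    using rho r by (simp add: add_pos_nonneg)
  have t: "\<rho> ^ (Suc k * (Suc k - 1) div 2) = \<rho> ^ (k * (k - 1) div 2) * \<rho> ^ k"
    using triangular_Suc[of k] by (simp add: power_add)
  have "pq_power 1 \<rho> (Suc (Suc m + Suc k)) r = P * (1 + \<rho> ^ (Suc m + Suc k) * r)"
    using q_power_Suc[of "Suc m + Suc k"] by (simp add: P_def)
  then have "baskakov_weight \<rho> (Suc m) r (Suc k) * (1 + \<rho> ^ (Suc m + Suc k) * r) =
    pq_binomial 1 \<rho> (Suc m + Suc k) (Suc k) * (\<rho> ^ (k * (k - 1) div 2) * \<rho> ^ k) * r ^ Suc k / P"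
    using s unfolding baskakov_weight_def t by simp
  moreover have "baskakov_weight \<rho> m r (Suc k) =
    pq_binomial 1 \<rho> (m + Suc k) (Suc k) * (\<rho> ^ (k * (k - 1) div 2) * \<rho> ^ k) * r ^ Suc k / P"
    unfolding baskakov_weight_def t P_def by simp
  moreover have "baskakov_weight \<rho> (Suc m) r k =
    pq_binomial 1 \<rho> (Suc m + k) k * \<rho> ^ (k * (k - 1) div 2) * r ^ k / P"
    unfolding baskakov_weight_def P_def by simp
  ultimately show ?thesis
    using P by (simp only: q_binomial_Pascal) (simp add: field_simps power_add)
qed

text \<open>
  By Pascal's rule the partial sums for \<open>m + 1\<close> and for \<open>m\<close> differ by a single boundary term \<open>u K\<close>. It
  tends to 0 because it carries the factor \<open>\<rho>\<^sup>K\<close>, while the weights themselves stay below the partial sums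
  for \<open>m\<close>, hence below 1.
\<close>

lemma baskakov_weight_sums: "baskakov_weight \<rho> m r sums 1"
proof (induction m)
  case 0
  show ?case by (rule baskakov_weight_0_sums)
next
  case (Suc m)
  define u where "u k = \<rho> ^ (Suc m + k) * r * baskakov_weight \<rho> (Suc m) r k" for k
  have u_nn: "0 \<le> u k" for k
    unfolding u_def using rho r baskakov_weight_nonneg by simp
  have w0: "baskakov_weight \<rho> (Suc m) r 0 = baskakov_weight \<rho> m r 0 - u 0"
  proof -
    have s: "1 + \<rho> ^ Suc m * r > 0" using rho r by (simp add: add_pos_nonneg del: power_Suc)
    have "baskakov_weight \<rho> (Suc m) r 0 * (1 + \<rho> ^ Suc m * r) = baskakov_weight \<rho> m r 0"
      using s q_fact_pos[of m] q_fact_pos[of "Suc m"]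
      by (simp add: baskakov_weight_def pq_binomial_def q_power_Suc[of "Suc m"] del: power_Suc)
    then show ?thesis by (simp add: u_def algebra_simps)
  qed
  have part: "(\<Sum>k\<le>K. baskakov_weight \<rho> (Suc m) r k) = (\<Sum>k\<le>K. baskakov_weight \<rho> m r k) - u K" for K
  proof (induction K)
    case 0
    show ?case by (simp add: w0)
  next
    case (Suc K)
    then show ?case using baskakov_weight_Pascal[of m K]
      by (simp add: u_def algebra_simps)
  qed
  have w_le: "baskakov_weight \<rho> (Suc m) r K \<le> 1" for K
  proof -
    have "baskakov_weight \<rho> (Suc m) r K \<le> (\<Sum>k\<le>K. baskakov_weight \<rho> (Suc m) r k)"
      by (rule member_le_sum) (auto simp: baskakov_weight_nonneg)
    also have "\<dots> \<le> (\<Sum>k\<le>K. baskakov_weight \<rho> m r k)"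
      using part u_nn by simp
    also have "\<dots> \<le> 1"
      using sum_le_suminf[OF sums_summable[OF Suc], of "{..K}"] sums_unique[OF Suc]
      by (simp add: baskakov_weight_nonneg)
    finally show ?thesis .
  qed
  have "(\<lambda>K. \<rho> ^ (Suc m + K) * r) \<longlonglongrightarrow> 0"
    using LIMSEQ_ignore_initial_segment[OF LIMSEQ_power_zero[of \<rho>], of "Suc m"] rho
    by (intro tendsto_mult_left_zero) (simp add: add.commute)
  moreover have "u K \<le> \<rho> ^ (Suc m + K) * r" for K
    unfolding u_def using mult_left_mono[OF w_le[of K], of "\<rho> ^ (Suc m + K) * r"] rho r by simp
  ultimately have "u \<longlonglongrightarrow> 0"
    using u_nn Lim_null_comparison[of u "\<lambda>K. \<rho> ^ (Suc m + K) * r"] by simp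
  with Suc[unfolded sums_def_le] have "(\<lambda>K. (\<Sum>k\<le>K. baskakov_weight \<rho> m r k) - u K) \<longlonglongrightarrow> 1 - 0"
    by (intro tendsto_diff)
  then show ?case unfolding sums_def_le part by simp
qed

text \<open>
  Multiplication by a node raises \<open>m\<close> by one and shifts \<open>k\<close>, because \<open>[k + 1]\<close> is absorbed into the
  binomial coefficient. Together with the fact that all weights have sum 1, it yields the moments.
\<close>

lemma baskakov_weight_mult_node:
  "baskakov_weight \<rho> m r (Suc k) * baskakov_node \<rho> (Suc m) (Suc k) =
   r * baskakov_weight \<rho> (Suc m) r k"
proof -
  define P where "P = pq_power 1 \<rho> (Suc (Suc (m + k))) r"
  define B where "B = pq_binomial 1 \<rho> (m + Suc k) (Suc k)"
  define N where "N = pq_num 1 \<rho> (Suc m)"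
  have P: "P > 0" and N: "N > 0" by (simp_all add: P_def N_def q_power_pos q_num_pos)
  have t: "\<rho> ^ (Suc k * (Suc k - 1) div 2) = \<rho> ^ (k * (k - 1) div 2) * \<rho> ^ k"
    using triangular_Suc[of k] by (simp add: power_add)
  have "baskakov_weight \<rho> m r (Suc k) * baskakov_node \<rho> (Suc m) (Suc k) =
    B * (\<rho> ^ (k * (k - 1) div 2) * \<rho> ^ k) * r ^ Suc k / P
      * (\<rho> * pq_num 1 \<rho> (Suc k) / (\<rho> ^ Suc k * N))"
    unfolding baskakov_weight_def baskakov_node_def t B_def P_def N_def by simp
  also have "\<dots> = (B * pq_num 1 \<rho> (Suc k)) * \<rho> ^ (k * (k - 1) div 2) * r ^ Suc k / (P * N)"
    using rho P N by (simp add: field_simps)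
  also have "B * pq_num 1 \<rho> (Suc k) = N * pq_binomial 1 \<rho> (Suc m + k) k"
    unfolding B_def N_def by (rule q_binomial_absorb)
  also have "N * pq_binomial 1 \<rho> (Suc m + k) k * \<rho> ^ (k * (k - 1) div 2) * r ^ Suc k / (P * N)
    = r * baskakov_weight \<rho> (Suc m) r k"
    using N unfolding baskakov_weight_def P_def by simp
  finally show ?thesis .
qed

lemma baskakov_node_0: "baskakov_node \<rho> n 0 = 0"
  by (simp add: baskakov_node_def q_num_0)

lemma baskakov_first_moment:
  "(\<lambda>k. baskakov_weight \<rho> m r k * baskakov_node \<rho> (Suc m) k) sums r"
proof -
  have "(\<lambda>k. r * baskakov_weight \<rho> (Suc m) r k) sums (r * 1)"
    by (intro sums_mult baskakov_weight_sums)
  then have "(\<lambda>k. baskakov_weight \<rho> m r (Suc k) * baskakov_node \<rho> (Suc m) (Suc k)) sums r"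
    by (simp add: baskakov_weight_mult_node)
  then show ?thesis
    by (subst (asm) sums_Suc_iff) (simp add: baskakov_node_0)
qed

text \<open>
  The second moment meets the node with index \<open>k + 1\<close> against the weights for \<open>m + 1\<close>. Since
  \<open>[k + 1] = [k] + \<rho>\<^sup>k\<close>, that node is an affine function of the node belonging to those weights.
\<close>

lemma baskakov_node_Suc:
  "baskakov_node \<rho> (Suc m) (Suc k) =
     1 / pq_num 1 \<rho> (Suc m)
     + pq_num 1 \<rho> (Suc (Suc m)) / (\<rho> * pq_num 1 \<rho> (Suc m)) * baskakov_node \<rho> (Suc (Suc m)) k"
proof -
  have "pq_num 1 \<rho> (Suc (Suc m)) > 0" "pq_num 1 \<rho> (Suc m) > 0"
    by (rule q_num_pos)+
  then show ?thesis
    unfolding baskakov_node_def q_num_Suc[of k] using rho by (simp add: field_simps)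
qed

lemma baskakov_second_moment:
  "(\<lambda>k. baskakov_weight \<rho> m r k * (baskakov_node \<rho> (Suc m) k)\<^sup>2) sums
     (r\<^sup>2 + (r + r\<^sup>2 / \<rho>) / pq_num 1 \<rho> (Suc m))"
proof -
  define a where "a = pq_num 1 \<rho> (Suc m)"
  define b where "b = pq_num 1 \<rho> (Suc (Suc m))"
  have a: "a > 0" unfolding a_def by (rule q_num_pos)
  have b: "b = 1 + \<rho> * a"
    using q_num_add[of 1 "Suc m"] q_num_Suc[of 0] by (simp add: a_def b_def q_num_0)
  have "(\<lambda>k. r / a * baskakov_weight \<rho> (Suc m) r k
         + r * b / (\<rho> * a) * (baskakov_weight \<rho> (Suc m) r k * baskakov_node \<rho> (Suc (Suc m)) k))
       sums (r / a * 1 + r * b / (\<rho> * a) * r)"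
    by (intro sums_add sums_mult baskakov_weight_sums baskakov_first_moment)
  also have "(\<lambda>k. r / a * baskakov_weight \<rho> (Suc m) r k
         + r * b / (\<rho> * a) * (baskakov_weight \<rho> (Suc m) r k * baskakov_node \<rho> (Suc (Suc m)) k))
      = (\<lambda>k. baskakov_weight \<rho> m r (Suc k) * (baskakov_node \<rho> (Suc m) (Suc k))\<^sup>2)"
  proof
    fix k
    have "baskakov_weight \<rho> m r (Suc k) * (baskakov_node \<rho> (Suc m) (Suc k))\<^sup>2
        = r * baskakov_weight \<rho> (Suc m) r k * baskakov_node \<rho> (Suc m) (Suc k)"
      by (simp add: power2_eq_square mult.assoc[symmetric] baskakov_weight_mult_node)
    then show "r / a * baskakov_weight \<rho> (Suc m) r k
         + r * b / (\<rho> * a) * (baskakov_weight \<rho> (Suc m) r k * baskakov_node \<rho> (Suc (Suc m)) k)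
      = baskakov_weight \<rho> m r (Suc k) * (baskakov_node \<rho> (Suc m) (Suc k))\<^sup>2"
      by (simp add: baskakov_node_Suc a_def b_def algebra_simps)
  qed
  also have "r / a * 1 + r * b / (\<rho> * a) * r = r\<^sup>2 + (r + r\<^sup>2 / \<rho>) / a"
    using a rho by (simp add: b field_simps power2_eq_square)
  finally show ?thesis
    unfolding a_def[symmetric]
    by (subst (asm) sums_Suc_iff) (simp add: baskakov_node_0)
qed

lemma baskakov_node_nonneg: "0 \<le> baskakov_node \<rho> (Suc m) k"
  unfolding baskakov_node_def
  using rho q_num_pos[of m] by (simp add: q_num_eq_sum[of k] sum_nonneg)

end
end

text \<open>
  After division by \<open>a\<close> the equation says that \<open>r\<^sup>2 + (r + r\<^sup>2 / \<rho>) / a = x\<^sup>2\<close>, that is, the second moment at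
  \<open>r\<close> is \<open>x\<^sup>2\<close>.
\<close>

lemma king_r_nonneg_and_quadratic:
  fixes m :: nat and x :: real
  assumes "0 < q" "q < p"
  defines "a \<equiv> pq_num 1 (q / p) (Suc m)" and "r \<equiv> king_r p q (Suc m) x"
  shows "0 \<le> r" and "(a + p / q) * r\<^sup>2 + r = a * x\<^sup>2"
proof -
  have p: "0 < p" using assms by simp
  have a: "a > 0" unfolding a_def using assms p by (intro q_num_pos) auto
  define c where "c = p ^ m"
  have c: "c > 0" using p by (simp add: c_def)
  define A where "A = c * (a + p / q)"
  have A: "A > 0" using a c p assms by (simp add: A_def add_pos_pos)
  define N where "N = c * a"
  have N: "N > 0" using a c by (simp add: N_def)
  define D where "D = c\<^sup>2 + 4 * N * A * x\<^sup>2"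
  have num: "pq_num p q (Suc m) = N"
    using pq_num_homogeneous[OF assms(1,2)] by (simp add: N_def c_def a_def)
  have den: "pq_num p q (Suc m) + p ^ Suc m / q = A"
    unfolding num by (simp add: N_def A_def c_def algebra_simps)
  have rD: "r = (- c + sqrt D) / (2 * A)"
    unfolding r_def king_r_def den unfolding num D_def
    by (simp add: c_def power_mult[symmetric] mult.commute)
  have "c\<^sup>2 \<le> D" using N A by (simp add: D_def)
  then have cD: "c \<le> sqrt D" using c by (simp add: real_le_rsqrt)
  then show "0 \<le> r" using A by (simp add: rD)
  have "D \<ge> 0" using \<open>c\<^sup>2 \<le> D\<close> by (meson order_trans zero_le_power2)
  then have "(2 * A * r + c)\<^sup>2 = D"
    using A by (simp add: rD)
  then have "4 * A * (A * r\<^sup>2 + c * r) = 4 * A * (N * x\<^sup>2)"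
    by (simp add: D_def power2_eq_square algebra_simps)
  then have "A * r\<^sup>2 + c * r = N * x\<^sup>2" using A by simp
  then have "c * ((a + p / q) * r\<^sup>2 + r) = c * (a * x\<^sup>2)"
    by (simp add: A_def N_def algebra_simps)
  then show "(a + p / q) * r\<^sup>2 + r = a * x\<^sup>2" using c by simp
qed

section \<open>A Korovkin-type estimate for functions of quadratic growth\<close>

text \<open>
  If the limit of the absolute value is positive, the function has no zeros far out, so by the
  intermediate value theorem its sign is eventually constant.
\<close>

lemma tendsto_of_tendsto_abs_at_top:
  fixes g :: "real \<Rightarrow> real"
  assumes cont: "continuous_on {0..} g" and lim: "((\<lambda>x. \<bar>g x\<bar>) \<longlongrightarrow> L) at_top"
  shows "\<exists>L'. (g \<longlongrightarrow> L') at_top"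
proof (cases "L = 0")
  case True
  then show ?thesis using lim tendsto_rabs_zero_cancel by blast
next
  case False
  have "L \<ge> 0"
    by (rule tendsto_lowerbound[OF lim]) auto
  with False have "L > 0" by simp
  then have "eventually (\<lambda>x. 0 < \<bar>g x\<bar>) at_top"
    by (rule order_tendstoD(1)[OF lim])
  then obtain N0 where N0: "\<And>x. x \<ge> N0 \<Longrightarrow> \<bar>g x\<bar> > 0"
    by (auto simp: eventually_at_top_linorder)
  define N where "N = max N0 0"
  have nz: "g x \<noteq> 0" if "x \<ge> N" for x
    using N0[of x] that by (auto simp: N_def)
  have "connected (g ` {N..})"
    by (intro connected_continuous_image continuous_on_subset[OF cont]) (auto simp: N_def)
  then have iv: "is_interval (g ` {N..})" by (simp add: is_interval_connected_1)
  have sgn: "(\<forall>x\<ge>N. g x > 0) \<or> (\<forall>x\<ge>N. g x < 0)"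
  proof (rule ccontr)
    assume "\<not> ?thesis"
    then obtain x y where "x \<ge> N" "y \<ge> N" "g x \<le> 0" "g y \<ge> 0" by force
    then have "0 \<in> g ` {N..}"
      using iv unfolding is_interval_1 by (meson atLeast_iff image_eqI)
    then show False using nz by force
  qed
  then show ?thesis
  proof
    assume "\<forall>x\<ge>N. g x > 0"
    then have "eventually (\<lambda>x. \<bar>g x\<bar> = g x) at_top"
      unfolding eventually_at_top_linorder by (meson abs_of_pos)
    then show ?thesis using Lim_transform_eventually[OF lim] by blast
  next
    assume "\<forall>x\<ge>N. g x < 0"
    then have "eventually (\<lambda>x. - \<bar>g x\<bar> = g x) at_top"
      unfolding eventually_at_top_linorder by (metis abs_of_neg minus_minus)
    then show ?thesis using Lim_transform_eventually[OF tendsto_minus[OF lim]] by blast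
  qed
qed

text \<open>
  For close points, either both lie in a compact interval, where \<open>g\<close> is uniformly continuous, or both lie
  in the tail, where \<open>g\<close> is small against \<open>1 + x\<^sup>2\<close>. For points at distance at least \<open>d\<close>, the bounded part of
  \<open>g\<close> is absorbed by \<open>C (t - x)\<^sup>2 \<ge> C d\<^sup>2\<close>.
\<close>

lemma increment_bound_vanishing:
  fixes g :: "real \<Rightarrow> real"
  assumes cont: "continuous_on {0..} g" and lim: "((\<lambda>x. g x / (1 + x\<^sup>2)) \<longlongrightarrow> 0) at_top"
    and "e > 0"
  shows "\<exists>C\<ge>0. \<forall>t\<ge>0. \<forall>x\<ge>0. \<bar>g t - g x\<bar> \<le> e * (2 + t\<^sup>2 + x\<^sup>2) + C * (t - x)\<^sup>2"
proof -
  have wpos: "1 + x\<^sup>2 > 0" for x :: real by (simp add: add_pos_nonneg)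
  have "eventually (\<lambda>x. \<bar>g x / (1 + x\<^sup>2)\<bar> < e) at_top"
    using tendstoD[OF lim \<open>e > 0\<close>] by simp
  then obtain N0 where N0: "\<And>x. x \<ge> N0 \<Longrightarrow> \<bar>g x / (1 + x\<^sup>2)\<bar> < e"
    by (auto simp: eventually_at_top_linorder)
  define N where "N = max N0 0"
  have tail: "\<bar>g x\<bar> \<le> e * (1 + x\<^sup>2)" if "x \<ge> N" for x
    using N0[of x] that wpos[of x] by (simp add: N_def divide_less_eq)
  have contN: "continuous_on {0..N+1} g"
    by (rule continuous_on_subset[OF cont]) auto
  have "bounded (g ` {0..N+1})"
    by (intro compact_imp_bounded compact_continuous_image contN) simp
  then obtain M where M: "M > 0" "\<And>x. x \<in> {0..N+1} \<Longrightarrow> \<bar>g x\<bar> \<le> M"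
    by (auto simp: bounded_pos)
  have bd: "\<bar>g x\<bar> \<le> M + e * (1 + x\<^sup>2)" if "x \<ge> 0" for x
  proof (cases "x \<ge> N")
    case True
    then show ?thesis using tail[of x] M(1) by simp
  next
    case False
    then show ?thesis using M(2)[of x] that \<open>e > 0\<close> wpos[of x]
      by (smt (verit) atLeastAtMost_iff mult_pos_pos)
  qed
  have "uniformly_continuous_on {0..N+1} g"
    by (intro compact_uniformly_continuous contN) simp
  then obtain d0 where d0: "d0 > 0"
    "\<And>x t. x \<in> {0..N+1} \<Longrightarrow> t \<in> {0..N+1} \<Longrightarrow> \<bar>t - x\<bar> < d0 \<Longrightarrow> \<bar>g t - g x\<bar> < e"
    using \<open>e > 0\<close> unfolding uniformly_continuous_on_def dist_real_def by metis
  \<comment> \<open>With \<open>d \<le> 1\<close>, points closer than \<open>d\<close> cannot straddle the strip between \<open>N\<close> and \<open>N + 1\<close>.\<close>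
  define d where "d = min d0 1"
  have d: "d > 0" "d \<le> d0" "d \<le> 1" using d0 by (auto simp: d_def)
  define C where "C = 2 * M / d\<^sup>2"
  have C: "C \<ge> 0" using M d by (simp add: C_def)
  have "\<bar>g t - g x\<bar> \<le> e * (2 + t\<^sup>2 + x\<^sup>2) + C * (t - x)\<^sup>2" if t: "t \<ge> 0" and x: "x \<ge> 0" for t x
  proof (cases "\<bar>t - x\<bar> < d")
    case True
    have "\<bar>g t - g x\<bar> \<le> e * (2 + t\<^sup>2 + x\<^sup>2)"
    proof (cases "t \<le> N + 1 \<and> x \<le> N + 1")
      case near: True
      then have "\<bar>g t - g x\<bar> \<le> e * 1"
        using d0(2)[of x t] t x True d by simp
      also have "\<dots> \<le> e * (2 + t\<^sup>2 + x\<^sup>2)"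
        using \<open>e > 0\<close> by (intro mult_left_mono) auto
      finally show ?thesis .
    next
      case False
      then have "t \<ge> N" "x \<ge> N" using True d by auto
      then show ?thesis using tail[of t] tail[of x] by (simp add: algebra_simps)
    qed
    then show ?thesis using C by (smt (verit) mult_nonneg_nonneg zero_le_power2)
  next
    case False
    then have "d\<^sup>2 \<le> (t - x)\<^sup>2" using d by (simp add: abs_le_square_iff[symmetric])
    then have "2 * M \<le> C * (t - x)\<^sup>2"
      using d M by (simp add: C_def field_simps)
    then show ?thesis using bd[OF t] bd[OF x] by (simp add: algebra_simps)
  qed
  with C show ?thesis by blast
qed

text \<open>
  The term \<open>L (t\<^sup>2 - x\<^sup>2)\<close> is the increment of the leading part \<open>L (1 + t\<^sup>2)\<close>, which an operator reproducing
  \<open>1\<close> and \<open>t\<^sup>2\<close> does not see. The class only controls the absolute value of \<open>f\<close> at infinity, so the signed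
  limit \<open>L\<close> comes from continuity.
\<close>

lemma weighted_Cstar_increment_bound:
  assumes f: "f \<in> weighted_Cstar 2"
  shows "\<exists>L. \<forall>e>0. \<exists>C\<ge>0. \<forall>t\<ge>0. \<forall>x\<ge>0.
    \<bar>f t - f x - L * (t\<^sup>2 - x\<^sup>2)\<bar> \<le> e * (2 + t\<^sup>2 + x\<^sup>2) + C * (t - x)\<^sup>2"
proof -
  have wpos: "1 + x\<^sup>2 > 0" for x :: real by (simp add: add_pos_nonneg)
  have cont: "continuous_on {0..} f"
    using f by (simp add: weighted_Cstar_def weighted_C_def)
  obtain L0 where "((\<lambda>x. \<bar>f x\<bar> / (1 + x powr 2)) \<longlongrightarrow> L0) at_top"
    using f by (auto simp: weighted_Cstar_def)
  moreover have "eventually (\<lambda>x::real. \<bar>f x\<bar> / (1 + x powr 2) = \<bar>f x / (1 + x\<^sup>2)\<bar>) at_top"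
    using eventually_gt_at_top[of 0] by eventually_elim (simp add: wpos less_imp_le)
  ultimately have "((\<lambda>x. \<bar>f x / (1 + x\<^sup>2)\<bar>) \<longlongrightarrow> L0) at_top"
    by (rule Lim_transform_eventually)
  moreover have "continuous_on {0..} (\<lambda>x. f x / (1 + x\<^sup>2))"
    using cont wpos by (intro continuous_intros) (auto simp: less_imp_neq[THEN not_sym])
  ultimately obtain L where L: "((\<lambda>x. f x / (1 + x\<^sup>2)) \<longlongrightarrow> L) at_top"
    using tendsto_of_tendsto_abs_at_top by blast
  define g where "g x = f x - L * (1 + x\<^sup>2)" for x
  have contg: "continuous_on {0..} g"
    unfolding g_def using cont by (intro continuous_intros)
  have "g x / (1 + x\<^sup>2) = f x / (1 + x\<^sup>2) - L" for x
    using wpos[of x] by (simp add: g_def field_simps)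
  then have "((\<lambda>x. g x / (1 + x\<^sup>2)) \<longlongrightarrow> 0) at_top"
    using L by (simp add: LIM_zero)
  from increment_bound_vanishing[OF contg this] show ?thesis
    by (intro exI[of _ L]) (simp add: g_def algebra_simps)
qed

section \<open>Convergence of the operators\<close>

text \<open>
  Subtracting \<open>L (t\<^sup>2 - x\<^sup>2)\<close> does not change the error, because its image under the operator is 0. The
  increment bound is then integrated against the weights, with \<open>1\<close>, \<open>t\<close> and \<open>t\<^sup>2\<close> mapped to \<open>1\<close>, \<open>r\<close> and
  \<open>x\<^sup>2\<close>. The growth bound on \<open>f\<close> makes the series converge.
\<close>

lemma king_baskakov_error:
  assumes pq: "0 < q" "q < p" and x: "x \<ge> 0"
    and B: "\<And>t. t \<ge> 0 \<Longrightarrow> \<bar>f t\<bar> \<le> M * (1 + t\<^sup>2)"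
    and e: "e \<ge> 0" and C: "C \<ge> 0"
    and inc: "\<And>t. t \<ge> 0 \<Longrightarrow>
      \<bar>f t - f x - L * (t\<^sup>2 - x\<^sup>2)\<bar> \<le> e * (2 + t\<^sup>2 + x\<^sup>2) + C * (t - x)\<^sup>2"
  shows "\<bar>king_baskakov (Suc m) p q f x - f x\<bar>
    \<le> (2 * e + 2 * C * (1 + p / q) / pq_num 1 (q / p) (Suc m)) * (1 + x\<^sup>2)"
proof -
  define \<rho> where "\<rho> = q / p"
  have rho: "0 < \<rho>" "\<rho> < 1" using pq by (auto simp: \<rho>_def)
  define a where "a = pq_num 1 \<rho> (Suc m)"
  have a: "a > 0" unfolding a_def using rho by (rule q_num_pos)
  define r where "r = king_r p q (Suc m) x"
  have r: "0 \<le> r" and quad: "(a + 1 / \<rho>) * r\<^sup>2 + r = a * x\<^sup>2"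
    using king_r_nonneg_and_quadratic[OF pq, of m x] by (simp_all add: r_def a_def \<rho>_def)
  define w where "w = baskakov_weight \<rho> m r"
  define t where "t = baskakov_node \<rho> (Suc m)"
  have w: "0 \<le> w k" and t: "0 \<le> t k" for k
    using baskakov_weight_nonneg[OF rho r] baskakov_node_nonneg[OF rho r]
    by (simp_all add: w_def t_def)
  have diff: "x\<^sup>2 - r\<^sup>2 = (r + r\<^sup>2 / \<rho>) / a"
    using quad a rho by (simp add: field_simps)
  have m0: "w sums 1" and m1: "(\<lambda>k. w k * t k) sums r"
    using baskakov_weight_sums[OF rho r] baskakov_first_moment[OF rho r]
    by (simp_all add: w_def t_def)
  have m2: "(\<lambda>k. w k * (t k)\<^sup>2) sums x\<^sup>2"
    using baskakov_second_moment[OF rho r, of m] by (simp add: w_def t_def a_def[symmetric] diff[symmetric])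
  have "summable (\<lambda>k. w k * f (t k))"
  proof (rule summable_comparison_test)
    have "norm (w k * f (t k)) \<le> M * (w k + w k * (t k)\<^sup>2)" for k
      using mult_left_mono[OF B[OF t[of k]] w[of k]] w[of k]
      by (simp add: abs_mult algebra_simps)
    then show "\<exists>N. \<forall>k\<ge>N. norm (w k * f (t k)) \<le> M * (w k + w k * (t k)\<^sup>2)" by blast
    show "summable (\<lambda>k. M * (w k + w k * (t k)\<^sup>2))"
      using m0 m2 by (intro summable_mult summable_add) (auto dest: sums_summable)
  qed
  then have Bf: "(\<lambda>k. w k * f (t k)) sums king_baskakov (Suc m) p q f x"
    unfolding king_baskakov_eq[OF pq] by (simp add: w_def t_def r_def \<rho>_def summable_sums)
  have "(\<lambda>k. w k * f (t k) - f x * w k - L * (w k * (t k)\<^sup>2 - x\<^sup>2 * w k))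
      sums (king_baskakov (Suc m) p q f x - f x * 1 - L * (x\<^sup>2 - x\<^sup>2 * 1))"
    by (intro sums_diff sums_mult Bf m0 m2)
  then have err: "(\<lambda>k. w k * (f (t k) - f x - L * ((t k)\<^sup>2 - x\<^sup>2)))
      sums (king_baskakov (Suc m) p q f x - f x)"
    by (simp add: algebra_simps)
  have "(\<lambda>k. e * (2 * w k + w k * (t k)\<^sup>2 + x\<^sup>2 * w k)
       + C * (w k * (t k)\<^sup>2 - 2 * x * (w k * t k) + x\<^sup>2 * w k))
      sums (e * (2 * 1 + x\<^sup>2 + x\<^sup>2 * 1) + C * (x\<^sup>2 - 2 * x * r + x\<^sup>2 * 1))"
    by (intro sums_add sums_diff sums_mult m0 m1 m2)
  then have bnd: "(\<lambda>k. w k * (e * (2 + (t k)\<^sup>2 + x\<^sup>2) + C * (t k - x)\<^sup>2))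
      sums (2 * e * (1 + x\<^sup>2) + 2 * C * (x * (x - r)))"
    by (simp add: algebra_simps power2_eq_square)
  have le: "\<bar>w k * (f (t k) - f x - L * ((t k)\<^sup>2 - x\<^sup>2))\<bar>
      \<le> w k * (e * (2 + (t k)\<^sup>2 + x\<^sup>2) + C * (t k - x)\<^sup>2)" for k
    using mult_left_mono[OF inc[OF t[of k]] w[of k]] w[of k] by (simp add: abs_mult)
  have "\<bar>king_baskakov (Suc m) p q f x - f x\<bar> \<le> 2 * e * (1 + x\<^sup>2) + 2 * C * (x * (x - r))"
  proof (rule abs_leI)
    show "king_baskakov (Suc m) p q f x - f x \<le> 2 * e * (1 + x\<^sup>2) + 2 * C * (x * (x - r))"
      using sums_le[OF _ err bnd] le by (meson abs_le_D1)
    show "- (king_baskakov (Suc m) p q f x - f x) \<le> 2 * e * (1 + x\<^sup>2) + 2 * C * (x * (x - r))"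
      using sums_le[OF _ sums_minus[OF err] bnd] le by (meson abs_le_D2)
  qed
  moreover have "x * (x - r) \<le> (1 + 1 / \<rho>) / a * (1 + x\<^sup>2)"
  proof -
    have "(r + r\<^sup>2 / \<rho>) / a \<ge> 0" using r a rho by simp
    then have "r\<^sup>2 \<le> x\<^sup>2" using diff by simp
    then have rx: "r \<le> x" using x by (rule power2_le_imp_le)
    \<comment> \<open>Passing from \<open>x - r\<close> to \<open>x\<^sup>2 - r\<^sup>2\<close> makes the quadratic equation for \<open>r\<close> applicable.\<close>
    have "x * (x - r) \<le> (x + r) * (x - r)"
      using r rx by (intro mult_right_mono) auto
    also have "\<dots> = x\<^sup>2 - r\<^sup>2" by (simp add: algebra_simps power2_eq_square)
    also have "\<dots> = (r + r\<^sup>2 / \<rho>) / a" by (rule diff)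
    also have "\<dots> \<le> ((1 + x\<^sup>2) + (1 + x\<^sup>2) / \<rho>) / a"
    proof (intro divide_right_mono add_mono)
      have "0 \<le> (x - 1)\<^sup>2" by simp
      then have "2 * x \<le> 1 + x\<^sup>2" by (simp add: power2_eq_square algebra_simps)
      then show "r \<le> 1 + x\<^sup>2" using rx x by linarith
      show "r\<^sup>2 \<le> 1 + x\<^sup>2" using \<open>r\<^sup>2 \<le> x\<^sup>2\<close> by simp
    qed (use a rho in auto)
    also have "\<dots> = (1 + 1 / \<rho>) / a * (1 + x\<^sup>2)" by (simp add: algebra_simps add_divide_distrib)
    finally show ?thesis .
  qed
  then have "2 * C * (x * (x - r)) \<le> 2 * C * ((1 + 1 / \<rho>) / a * (1 + x\<^sup>2))"
    using C by (intro mult_left_mono) auto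
  ultimately have "\<bar>king_baskakov (Suc m) p q f x - f x\<bar>
      \<le> 2 * e * (1 + x\<^sup>2) + 2 * C * ((1 + 1 / \<rho>) / a * (1 + x\<^sup>2))"
    by linarith
  also have "\<dots> = (2 * e + 2 * C * (1 + 1 / \<rho>) / a) * (1 + x\<^sup>2)"
    by (simp add: distrib_right)
  finally show ?thesis by (simp add: a_def \<rho>_def)
qed

text \<open>
  For fixed \<open>N\<close> and all \<open>n \<ge> N\<close>, the number \<open>[n]\<^sub>\<rho>\<close> dominates its first \<open>N\<close> terms, whose sum tends to \<open>N\<close>.
\<close>

lemma q_num_tendsto_at_top:
  assumes rho: "\<And>n. n \<ge> 1 \<Longrightarrow> 0 < \<rho> n \<and> \<rho> n < 1" and lim: "\<rho> \<longlonglongrightarrow> 1"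
  shows "filterlim (\<lambda>n. pq_num 1 (\<rho> n) n) at_top sequentially"
  unfolding filterlim_at_top
proof
  fix Z :: real
  obtain N :: nat where N: "real N > Z" using reals_Archimedean2 by blast
  have "(\<lambda>n. \<Sum>i<N. \<rho> n ^ i) \<longlonglongrightarrow> (\<Sum>i<N. 1 ^ i)"
    by (intro tendsto_intros lim)
  then have "eventually (\<lambda>n. (\<Sum>i<N. \<rho> n ^ i) > Z) sequentially"
    using N by (intro order_tendstoD) auto
  then show "eventually (\<lambda>n. Z \<le> pq_num 1 (\<rho> n) n) sequentially"
    using eventually_ge_at_top[of "max 1 N"]
  proof eventually_elim
    case (elim n)
    then have r: "0 < \<rho> n" "\<rho> n < 1" using rho[of n] by auto
    have "(\<Sum>i<N. \<rho> n ^ i) \<le> (\<Sum>i<n. \<rho> n ^ i)"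
      using elim r by (intro sum_mono2) auto
    then show ?case using elim by (simp add: q_num_eq_sum[OF r])
  qed
qed

theorem theorem1:
  fixes p q :: "nat \<Rightarrow> real" and f :: "real \<Rightarrow> real"
  assumes q_range: "\<And>n. n \<ge> 1 \<Longrightarrow> 0 < q n \<and> q n < 1"
    and p_range: "\<And>n. n \<ge> 1 \<Longrightarrow> 0 < p n \<and> p n \<le> 1"
    and q_less_p: "\<And>n. n \<ge> 1 \<Longrightarrow> q n < p n"
    and q_lim: "q \<longlonglongrightarrow> 1"
    and p_lim: "p \<longlonglongrightarrow> 1"
    and f: "f \<in> weighted_Cstar 2"
  shows "(\<lambda>n. weighted_norm 2 (\<lambda>x. king_baskakov n (p n) (q n) f x - f x)) \<longlonglongrightarrow> 0"
proof -
  define a where "a n = pq_num 1 (q n / p n) n" for n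
  obtain M where M: "\<And>t. t \<ge> 0 \<Longrightarrow> \<bar>f t\<bar> \<le> M * (1 + t\<^sup>2)"
    using f by (auto simp: weighted_Cstar_def weighted_C_def weighted_B_def)
  obtain L where L: "\<And>e. e > 0 \<Longrightarrow> \<exists>C\<ge>0. \<forall>t\<ge>0. \<forall>x\<ge>0.
    \<bar>f t - f x - L * (t\<^sup>2 - x\<^sup>2)\<bar> \<le> e * (2 + t\<^sup>2 + x\<^sup>2) + C * (t - x)\<^sup>2"
    using weighted_Cstar_increment_bound[OF f] by blast
  have ratio: "(\<lambda>n. q n / p n) \<longlonglongrightarrow> 1" "(\<lambda>n. p n / q n) \<longlonglongrightarrow> 1"
    using tendsto_divide[OF q_lim p_lim] tendsto_divide[OF p_lim q_lim] by simp_all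
  have a_lim: "filterlim a at_top sequentially"
    unfolding a_def using q_range p_range q_less_p
    by (intro q_num_tendsto_at_top ratio) auto
  show ?thesis
  proof (rule order_tendstoI)
    fix y :: ereal assume "y < 0"
    have "0 \<le> weighted_norm 2 g" for g
      unfolding weighted_norm_def by (rule SUP_upper2[of 0]) auto
    with \<open>y < 0\<close> show "\<forall>\<^sub>F n in sequentially.
        y < weighted_norm 2 (\<lambda>x. king_baskakov n (p n) (q n) f x - f x)"
      by (intro always_eventually allI) (rule less_le_trans)
  next
    fix y :: ereal assume "0 < y"
    then obtain \<epsilon> where eps: "0 < \<epsilon>" "ereal \<epsilon> < y"
      using ereal_dense2[of 0 y] by auto
    define e where "e = \<epsilon> / 4"
    have e: "e > 0" using eps by (simp add: e_def)
    obtain C where C: "C \<ge> 0" "\<And>t x. t \<ge> 0 \<Longrightarrow> x \<ge> 0 \<Longrightarrow>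
      \<bar>f t - f x - L * (t\<^sup>2 - x\<^sup>2)\<bar> \<le> e * (2 + t\<^sup>2 + x\<^sup>2) + C * (t - x)\<^sup>2"
      using L[OF e] by blast
    have "(\<lambda>n. 2 * C * (1 + p n / q n) / a n) \<longlonglongrightarrow> 0"
      by (rule tendsto_divide_0[OF tendsto_mult[OF tendsto_const
            tendsto_add[OF tendsto_const ratio(2)]] filterlim_at_top_imp_at_infinity[OF a_lim]])
    then have "eventually (\<lambda>n. 2 * C * (1 + p n / q n) / a n < 2 * e) sequentially"
      using e by (intro order_tendstoD) auto
    then show "\<forall>\<^sub>F n in sequentially.
        weighted_norm 2 (\<lambda>x. king_baskakov n (p n) (q n) f x - f x) < y"
      using eventually_ge_at_top[of 1]
    proof eventually_elim
      case (elim n)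
      then obtain m where n: "n = Suc m" by (cases n) auto
      have "weighted_norm 2 (\<lambda>x. king_baskakov n (p n) (q n) f x - f x) \<le> ereal \<epsilon>"
        unfolding weighted_norm_def
      proof (rule SUP_least)
        fix x :: real assume "x \<in> {0..}"
        then have x: "x \<ge> 0" by simp
        have pos: "1 + x\<^sup>2 > 0" by (simp add: add_pos_nonneg)
        have "\<bar>king_baskakov n (p n) (q n) f x - f x\<bar>
          \<le> (2 * e + 2 * C * (1 + p n / q n) / a n) * (1 + x\<^sup>2)"
          unfolding a_def using elim q_range q_less_p e
          unfolding n by (intro king_baskakov_error[OF _ _ x M _ C(1) C(2)[OF _ x]]) auto
        also have "\<dots> \<le> \<epsilon> * (1 + x\<^sup>2)"
          using elim pos by (intro mult_right_mono) (auto simp: e_def)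
        finally show "ereal (\<bar>king_baskakov n (p n) (q n) f x - f x\<bar> / (1 + x powr 2)) \<le> ereal \<epsilon>"
          using x pos by (simp add: divide_le_eq)
      qed
      then show ?case using eps(2) by (rule le_less_trans)
    qed
  qed
qed

end
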